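(* Let $\Lambda$ be a finite rooted tree and suppose that $X$ is a nondegenerate simple Markov chain on the $2$-spherical augmentation $\Lambda'$ of $\Lambda$. Then $X$ is determined by $2$-spherical first hitting times.
   Context: A finite rooted tree $\Lambda=(V,E)$ is a finite connected graph without cycles with a distinguished vertex $r$ (the root). A vertex is terminal if it has exactly one neighbor; $V_{\mathrm{term}}(\Lambda)$ is the set of terminal vertices (the root may be terminal). $|v|$ is the graph distance from $v$ to $r$, $V_k=V_k(\Lambda)=\{v\in V(\Lambda):|v|=k\}$ is the $k$-th shell, and $\mathrm{R}_{\mathrm{out}}(\Lambda)=\max_{v\in V(\Lambda)}|v|$. For $v\in V_{\mathrm{term}}(\Lambda)$ and $n\in\mathbb{N}$, the $n$-augmentation of $\Lambda$ at $v$ is the rooted tree (with the same root) obtained by attaching to $v$ a path $v=x_0,x_1,\dots,x_n$ with $x_1,\dots,x_n$ new vertices. For $l\in\mathbb{N}$, the $l$-spherical augmentation $\Lambda'$ of $\Lambda$ is obtained by performing, for every $v\in V_{\mathrm{term}}(\Lambda)$, the $(\mathrm{R}_{\mathrm{out}}(\Lambda)-|v|+l)$-augmentation at $v$; $\Lambda$ is naturally a subtree of $\Lambda'$. All terminal vertices of $\Lambda'$ have norm $\mathrm{R}_{\mathrm{out}}(\Lambda')=\mathrm{R}_{\mathrm{out}}(\Lambda)+l$. A nondegenerate simple Markov chain on $\Lambda'$ is a Markov chain on $V(\Lambda')$ whose one-step transition probabilities $t_{xy}$, at each nonterminal vertex $x$ of $\Lambda'$, are strictly positive exactly when $y$ is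 a neighbor of $x$ (and sum to $1$ over the neighbors of $x$); the chain is killed upon reaching terminal vertices of $\Lambda'$. $X$ is determined by $l$-spherical first hitting times if the transition probabilities for vertices in $\Lambda$ are completely determined by the triple $(W,\mathbb{P}_{\mathrm{out}}^r,\mathbb{P}_{\mathrm{in}}^r)$, where $W$ is the collection of transition probabilities for vertices in $V(\Lambda')\setminus V(\Lambda)$, $\mathbb{P}_{\mathrm{out}}^r$ is the joint distribution of first hitting time and hitting place of $X$ started at $r$ for the shell $V_{\mathrm{R}_{\mathrm{out}}(\Lambda')}(\Lambda')$, and $\mathbb{P}_{\mathrm{in}}^r$ is the joint distribution of first hitting time and hitting place of $X$ started at $r$ for the shell $V_{\mathrm{R}_{\mathrm{out}}(\Lambda')-1}(\Lambda')$. "Completely determined" means: any nondegenerate simple Markov chain on the same $\Lambda'$ with the same triple has the same transition probabilities at the vertices of $\Lambda$. The joint distribution for a set $A$ is $(k,v)\mapsto\mathbb{P}^r(\tau_A=k,X_{\tau_A}=v)$ with $\tau_A=\inf\{n\ge 0:X_n\in A\}$, $v\in A$. *)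

theory Defs
  imports "HOL-Probability.Probability" "Graph_Theory.Pair_Digraph" "Graph_Theory.Digraph_Component"
begin

section \<open>Finite rooted trees\<close>

text \<open>
  A finite simple undirected graph is a \<open>pair_graph\<close>: a finite, loop-free digraph whose arc set is
  a symmetric relation.  Every edge of it, traversed forth and back, is a \<open>cycle\<close> of length 2 in the
  sense of Graph_Theory, so the cycles of the undirected graph are those of length at least 3 (and
  the predicate \<open>tree\<close> of Graph_Theory is not applicable to symmetric digraphs).
\<close>

definition finite_rooted_tree :: "'a pair_pre_digraph \<Rightarrow> 'a \<Rightarrow> bool" where
  "finite_rooted_tree G r \<longleftrightarrow>
     pair_graph G \<and> Digraph_Component.connected (with_proj G) \<and>
     \<not> (\<exists>p. pre_digraph.cycle (with_proj G) p \<and> 3 \<le> length p) \<and>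
     r \<in> pverts G"

definition neighbors :: "'a pair_pre_digraph \<Rightarrow> 'a \<Rightarrow> 'a set" where
  "neighbors G v = {w. (v, w) \<in> parcs G}"

definition terminal_verts :: "'a pair_pre_digraph \<Rightarrow> 'a set" where
  "terminal_verts G = {v \<in> pverts G. card (neighbors G v) = 1}"

definition graph_dist :: "'a pair_pre_digraph \<Rightarrow> 'a \<Rightarrow> 'a \<Rightarrow> nat" where
  "graph_dist G u v = (LEAST n. \<exists>p. pre_digraph.awalk (with_proj G) u p v \<and> length p = n)"

definition shell :: "'a pair_pre_digraph \<Rightarrow> 'a \<Rightarrow> nat \<Rightarrow> 'a set" where
  "shell G r k = {v \<in> pverts G. graph_dist G v r = k}"

definition R_out :: "'a pair_pre_digraph \<Rightarrow> 'a \<Rightarrow> nat" where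
  "R_out G r = Max ((\<lambda>v. graph_dist G v r) ` pverts G)"


section \<open>Augmentations\<close>

text \<open>
  \<open>augment G n\<close> performs the \<open>n v\<close>-augmentation at every terminal vertex \<open>v\<close> of \<open>G\<close>
  simultaneously.  The vertex \<open>v\<close> of \<open>G\<close> becomes \<open>(v, 0)\<close>, and \<open>(v, 0), (v, 1), \<dots>, (v, n v)\<close> is the
  path attached at a terminal vertex \<open>v\<close>.
\<close>

definition augment :: "'a pair_pre_digraph \<Rightarrow> ('a \<Rightarrow> nat) \<Rightarrow> ('a \<times> nat) pair_pre_digraph" where
  "augment G n =
     \<lparr> pverts = {(v, 0) | v. v \<in> pverts G} \<union> {(v, i) | v i. v \<in> terminal_verts G \<and> 1 \<le> i \<and> i \<le> n v},
       parcs = {((u, 0), (v, 0)) | u v. (u, v) \<in> parcs G} \<union>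
               {((v, i), (v, Suc i)) | v i. v \<in> terminal_verts G \<and> i < n v} \<union>
               {((v, Suc i), (v, i)) | v i. v \<in> terminal_verts G \<and> i < n v} \<rparr>"

definition spherical_augmentation ::
    "'a pair_pre_digraph \<Rightarrow> 'a \<Rightarrow> nat \<Rightarrow> ('a \<times> nat) pair_pre_digraph" where
  "spherical_augmentation G r l = augment G (\<lambda>v. R_out G r - graph_dist G v r + l)"

definition original_verts :: "'a pair_pre_digraph \<Rightarrow> ('a \<times> nat) set" where
  "original_verts G = {(v, 0) | v. v \<in> pverts G}"


section \<open>Nondegenerate simple Markov chains\<close>

text \<open>The values of \<open>t x\<close> at terminal vertices \<open>x\<close> are irrelevant: the chain is killed there.\<close>

definition nondegenerate_simple :: "'v pair_pre_digraph \<Rightarrow> ('v \<Rightarrow> 'v \<Rightarrow> real) \<Rightarrow> bool" where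
  "nondegenerate_simple G t \<longleftrightarrow>
     (\<forall>x \<in> pverts G - terminal_verts G.
        (\<forall>y \<in> pverts G. 0 \<le> t x y \<and> (0 < t x y \<longleftrightarrow> y \<in> neighbors G x)) \<and>
        (\<Sum>y \<in> neighbors G x. t x y) = 1)"

text \<open>
  The state space is extended by a cemetery state \<open>None\<close>.  The chain does visit the terminal vertex
  at which it is killed, and moves to the cemetery in the next step.
\<close>

fun killed_kernel ::
    "'v pair_pre_digraph \<Rightarrow> ('v \<Rightarrow> 'v \<Rightarrow> real) \<Rightarrow> 'v option \<Rightarrow> 'v option \<Rightarrow> real" where
  "killed_kernel G t (Some x) (Some y) = (if x \<in> terminal_verts G then 0 else t x y)"
| "killed_kernel G t (Some x) None = (if x \<in> terminal_verts G then 1 else 0)"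
| "killed_kernel G t None (Some y) = 0"
| "killed_kernel G t None None = 1"

definition states :: "'v pair_pre_digraph \<Rightarrow> 'v option set" where
  "states G = insert None (Some ` pverts G)"

text \<open>
  \<open>M\<close> plays the role of the probability \<open>\<P>\<^sup>x\<close> under which the chain \<open>X\<close> with transition
  probabilities \<open>t\<close> starts at \<open>x\<close>.
\<close>

definition nondegenerate_simple_chain ::
    "'v pair_pre_digraph \<Rightarrow> ('v \<Rightarrow> 'v \<Rightarrow> real) \<Rightarrow> 'v \<Rightarrow> 'w measure \<Rightarrow> (nat \<Rightarrow> 'w \<Rightarrow> 'v option) \<Rightarrow> bool"
  where
  "nondegenerate_simple_chain G t x M X \<longleftrightarrow>
     nondegenerate_simple G t \<and>
     prob_space M \<and>
     (\<forall>n. X n \<in> M \<rightarrow>\<^sub>M count_space (states G)) \<and>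
     (AE \<omega> in M. X 0 \<omega> = Some x) \<and>
     (\<forall>n s. \<forall>y \<in> states G. \<P>(\<omega> in M. \<forall>i\<le>n. X i \<omega> = s i) > 0 \<longrightarrow>
        \<P>(\<omega> in M. X (Suc n) \<omega> = y \<bar> \<forall>i\<le>n. X i \<omega> = s i) = killed_kernel G t (s n) y)"


section \<open>First hitting times\<close>

definition hitting_time :: "(nat \<Rightarrow> 'w \<Rightarrow> 'v option) \<Rightarrow> 'v set \<Rightarrow> 'w \<Rightarrow> enat" where
  "hitting_time X A \<omega> = Inf {enat n | n. X n \<omega> \<in> Some ` A}"

definition hitting_distribution ::
    "'w measure \<Rightarrow> (nat \<Rightarrow> 'w \<Rightarrow> 'v option) \<Rightarrow> 'v set \<Rightarrow> nat \<Rightarrow> 'v \<Rightarrow> real" where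
  "hitting_distribution M X A k v = \<P>(\<omega> in M. hitting_time X A \<omega> = enat k \<and> X k \<omega> = Some v)"

text \<open>
  \<open>X\<close> is a chain on the \<open>l\<close>-spherical augmentation \<open>G'\<close> of \<open>G\<close>, started at the root, with transition
  probabilities \<open>t\<close>.  The competing chains \<open>Y\<close> may live on a different probability space; the first
  argument only fixes the type of its sample points.  The premises after the first state that the two
  chains agree in the transition probabilities outside \<open>G\<close> and in the joint distributions of hitting
  time and hitting place for the outermost shell and for the one before it.
\<close>

definition determined_by_spherical_hitting_times ::
    "'u itself \<Rightarrow> 'a pair_pre_digraph \<Rightarrow> 'a \<Rightarrow> nat \<Rightarrow> ('a \<times> nat \<Rightarrow> 'a \<times> nat \<Rightarrow> real) \<Rightarrow>
     'w measure \<Rightarrow> (nat \<Rightarrow> 'w \<Rightarrow> ('a \<times> nat) option) \<Rightarrow> bool" where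
  "determined_by_spherical_hitting_times _ G r l t M X \<longleftrightarrow>
     (let G' = spherical_augmentation G r l;
          r' = (r, 0);
          A_out = shell G' r' (R_out G' r');
          A_in = shell G' r' (R_out G' r' - 1)
      in \<forall>(N :: 'u measure) Y u.
           nondegenerate_simple_chain G' u r' N Y \<longrightarrow>
           (\<forall>x \<in> pverts G' - original_verts G - terminal_verts G'. \<forall>y \<in> pverts G'. u x y = t x y) \<longrightarrow>
           (\<forall>k. \<forall>v \<in> A_out. hitting_distribution N Y A_out k v = hitting_distribution M X A_out k v) \<longrightarrow>
           (\<forall>k. \<forall>v \<in> A_in. hitting_distribution N Y A_in k v = hitting_distribution M X A_in k v) \<longrightarrow>
           (\<forall>x \<in> original_verts G. \<forall>y \<in> pverts G'. u x y = t x y))"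

end

theory Submission
  imports Defs
begin

text \<open>
  The spherical augmentation is a tree all of whose leaves have the same depth \<open>L + 1\<close>, where
  \<open>L = R_out G r + 1\<close>.  Write \<open>a\<^sub>n(x)\<close> and \<open>b\<^sub>n(x)\<close> for the probability that the chain is at \<open>x\<close> at time
  \<open>n\<close> and has spent all earlier times at depth at most \<open>L\<close>, respectively at depth less than \<open>L\<close>.  The hitting
  distributions of the outer and the inner shell are the values of \<open>a\<close> at depth \<open>L + 1\<close> and of \<open>b\<close> at
  depth \<open>L\<close> (\<open>hitting_distribution_eq_taboo_prob\<close>).

  From these data the transition probabilities are recovered shell by shell from the leaves towards
  the root (\<open>nearest_neighbor_determined\<close>), together with \<open>a\<close> and \<open>b\<close>.  At depth \<open>L\<close> the transition
  probabilities are given, as this shell lies outside the original tree.  Let \<open>u\<close> be a child of \<open>s\<close>, and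
  suppose that everything strictly below \<open>s\<close> is known.  The chain enters \<open>u\<close> from \<open>s\<close> or from a child of
  \<open>u\<close>; subtracting the second contribution from \<open>a\<^sub>n\<^sub>+\<^sub>1(u)\<close> and \<open>b\<^sub>n\<^sub>+\<^sub>1(u)\<close> leaves the products
  \<open>p s u * a\<^sub>n(s)\<close> and \<open>p s u * b\<^sub>n(s)\<close> for all \<open>n\<close>.  It remains to separate the two factors.

  To this end consider \<open>a - b\<close>, the probability of being at \<open>s\<close> having already been at depth \<open>L\<close>
  (\<open>late_prob\<close>).  At the least time at which it can be nonzero, \<open>2 * L\<close> minus the depth of \<open>s\<close>, the chain has
  gone straight down to depth \<open>L\<close> and is coming straight back, so it enters \<open>s\<close> from a child.  This
  value is therefore computed from data below \<open>s\<close> (\<open>late_prob_first\<close>), and it is positive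
  (\<open>late_prob_pos\<close>).  Dividing the known product by it gives \<open>p s u\<close>, and then \<open>a\<close> and \<open>b\<close> at \<open>s\<close>.
  The transition probability from \<open>s\<close> to its parent is the remaining mass.
\<close>

section \<open>Recovering a nearest-neighbour walk on a tree of uniform depth\<close>

text \<open>
  For the Markov chain started at \<open>r\<close> with transition probabilities \<open>p\<close>, this is the probability of
  being at \<open>x\<close> at time \<open>n\<close> after having spent all earlier times in \<open>S\<close>.  Since \<open>x\<close> itself may lie outside \<open>S\<close>,
  the joint law of the exit time and the exit place is covered as well.
\<close>

primrec taboo_prob ::
    "'v set \<Rightarrow> ('v \<Rightarrow> 'v \<Rightarrow> real) \<Rightarrow> 'v \<Rightarrow> nat \<Rightarrow> 'v \<Rightarrow> real" where
  "taboo_prob S p r 0 x = of_bool (x = r)"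
| "taboo_prob S p r (Suc n) x = (\<Sum>y\<in>S. taboo_prob S p r n y * p y x)"

text \<open>
  A tree presented by the distance \<open>d\<close> from its root, all of whose leaves lie at the same depth
  \<open>Suc L\<close>.  This is the shape of a spherical augmentation; the inner and the outer shell of the theorem
  are the depths \<open>L\<close> and \<open>Suc L\<close>.
\<close>

locale layered_tree =
  fixes V :: "'v set" and E :: "'v rel" and d :: "'v \<Rightarrow> nat" and r :: 'v and L :: nat
  assumes finite_V: "finite V"
    and r_in_V: "r \<in> V"
    and E_sub: "E \<subseteq> V \<times> V"
    and E_sym: "(x, y) \<in> E \<Longrightarrow> (y, x) \<in> E"
    and d_eq_0: "x \<in> V \<Longrightarrow> d x = 0 \<longleftrightarrow> x = r"
    and d_bound: "x \<in> V \<Longrightarrow> d x \<le> Suc L"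
    and adjacent_layers: "(x, y) \<in> E \<Longrightarrow> d y = Suc (d x) \<or> d x = Suc (d y)"
    and parent_exists: "x \<in> V \<Longrightarrow> x \<noteq> r \<Longrightarrow> \<exists>y. (y, x) \<in> E \<and> d x = Suc (d y)"
    and parent_unique: "(y, x) \<in> E \<Longrightarrow> (z, x) \<in> E \<Longrightarrow> d x = Suc (d y) \<Longrightarrow> d x = Suc (d z) \<Longrightarrow> y = z"
    and child_exists: "x \<in> V \<Longrightarrow> d x \<le> L \<Longrightarrow> \<exists>y. (x, y) \<in> E \<and> d y = Suc (d x)"
begin

definition below :: "nat \<Rightarrow> 'v set" where
  "below j = {x \<in> V. d x < j}"

definition children :: "'v \<Rightarrow> 'v set" where
  "children x = {y. (x, y) \<in> E \<and> d y = Suc (d x)}"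

definition nearest_neighbor :: "('v \<Rightarrow> 'v \<Rightarrow> real) \<Rightarrow> bool" where
  "nearest_neighbor p \<longleftrightarrow>
     (\<forall>x\<in>V. d x \<le> L \<longrightarrow>
        (\<forall>y\<in>V. 0 \<le> p x y \<and> (0 < p x y \<longleftrightarrow> (x, y) \<in> E)) \<and> (\<Sum>y | (x, y) \<in> E. p x y) = 1)"

text \<open>
  For \<open>d x \<le> L\<close> this is the probability of being at \<open>x\<close> at time \<open>n\<close>, without having reached depth
  \<open>Suc L\<close>, but having visited depth \<open>L\<close> by time \<open>n\<close>.  At \<open>d x = L\<close> nothing is subtracted, because there
  the visit takes place at time \<open>n\<close> at the latest.
\<close>

definition late_prob :: "('v \<Rightarrow> 'v \<Rightarrow> real) \<Rightarrow> nat \<Rightarrow> 'v \<Rightarrow> real" where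
  "late_prob p n x =
     taboo_prob (below (Suc L)) p r n x - (if d x < L then taboo_prob (below L) p r n x else 0)"

lemma finite_below [simp]: "finite (below j)"
  using finite_V by (simp add: below_def)

lemma finite_children [simp]: "finite (children x)"
  using E_sub finite_V by (auto simp: children_def intro: finite_subset[of _ V])

lemma E_in_V: "(x, y) \<in> E \<Longrightarrow> x \<in> V" "(x, y) \<in> E \<Longrightarrow> y \<in> V"
  using E_sub by auto

lemma children_in_V: "y \<in> children x \<Longrightarrow> y \<in> V"
  by (auto simp: children_def dest: E_in_V)

lemma deepest_exists: "\<exists>x\<in>V. d x = Suc L"
proof -
  obtain x where x: "x \<in> V" "d x = Max (d ` V)"
    using Max_in[of "d ` V"] finite_V r_in_V by (metis empty_iff finite_imageI image_iff image_is_empty)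
  have "\<not> d x \<le> L"
  proof
    assume "d x \<le> L"
    then obtain y where "y \<in> V" and "d y = Suc (d x)" using child_exists[OF x(1)] E_in_V by blast
    from \<open>y \<in> V\<close> have "d y \<le> Max (d ` V)" using finite_V by simp
    then show False using \<open>d y = Suc (d x)\<close> x(2) by linarith
  qed
  then show ?thesis using x d_bound by (metis le_SucE)
qed

text \<open>
  A vertex above the leaves other than the root has a parent and a child.  The root has no
  parent, so for it the claim has to be assumed.
\<close>

lemma single_neighbor_iff:
  assumes root: "card {y. (r, y) \<in> E} \<noteq> 1" and x: "x \<in> V"
  shows "card {y. (x, y) \<in> E} = 1 \<longleftrightarrow> d x = Suc L"
proof (cases "d x \<le> L")
  case True
  have "card {y. (x, y) \<in> E} \<noteq> 1"
  proof (cases "x = r")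
    case False
    then obtain y where y: "(y, x) \<in> E" "d x = Suc (d y)" using parent_exists x by blast
    obtain z where z: "(x, z) \<in> E" "d z = Suc (d x)" using child_exists[OF x True] by blast
    have "y \<noteq> z" using y z by auto
    show ?thesis
    proof
      assume "card {y. (x, y) \<in> E} = 1"
      then obtain w where "{y. (x, y) \<in> E} = {w}" by (rule card_1_singletonE)
      then have "y = w" "z = w" using E_sym[OF y(1)] z(1) by blast+
      with \<open>y \<noteq> z\<close> show False by simp
    qed
  qed (use root in simp)
  then show ?thesis using True by simp
next
  case False
  then have dx: "d x = Suc L" using d_bound[OF x] by simp
  then have "x \<noteq> r" using d_eq_0[OF x] by auto
  then obtain y where y: "(y, x) \<in> E" "d x = Suc (d y)" using parent_exists x by blast
  have "z = y" if z: "(x, z) \<in> E" for z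
  proof -
    have "d z \<le> Suc L" using z E_in_V d_bound by blast
    then have "d x = Suc (d z)" using adjacent_layers[OF z] dx by simp
    then show ?thesis by (rule parent_unique[OF E_sym[OF z] y(1) _ y(2)])
  qed
  then have "{y. (x, y) \<in> E} = {y}" using E_sym[OF y(1)] by blast
  then show ?thesis using dx by simp
qed

lemma nearest_neighbor_0:
  assumes "nearest_neighbor p" "x \<in> V" "d x \<le> L" "y \<in> V" "(x, y) \<notin> E"
  shows "p x y = 0"
  using assms unfolding nearest_neighbor_def by (metis order_le_less)

lemma nearest_neighbor_pos: "nearest_neighbor p \<Longrightarrow> (x, y) \<in> E \<Longrightarrow> d x \<le> L \<Longrightarrow> 0 < p x y"
  unfolding nearest_neighbor_def using E_in_V by blast

lemma nearest_neighbor_nonneg: "nearest_neighbor p \<Longrightarrow> x \<in> V \<Longrightarrow> y \<in> V \<Longrightarrow> d x \<le> L \<Longrightarrow> 0 \<le> p x y"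
  unfolding nearest_neighbor_def by blast

text \<open>
  The parent \<open>s\<close> is the only neighbour of \<open>x\<close> from which \<open>x\<close> is entered from above.  This isolates the
  unknown \<open>p s x\<close> once everything below \<open>x\<close> is known.
\<close>

lemma inflow_split:
  assumes p: "nearest_neighbor p" and j: "j \<le> Suc L" and E: "(s, x) \<in> E" and d: "d x = Suc (d s)" and s: "d s < j"
  shows "(\<Sum>y\<in>below j. h y * p y x) = h s * p s x + (\<Sum>v\<in>children x \<inter> below j. h v * p v x)"
proof -
  have "(\<Sum>y\<in>below j. h y * p y x) = (\<Sum>y\<in>insert s (children x \<inter> below j). h y * p y x)"
  proof (rule sum.mono_neutral_right)
    show "insert s (children x \<inter> below j) \<subseteq> below j"
      using E s E_in_V by (auto simp: below_def)
    show "\<forall>y\<in>below j - insert s (children x \<inter> below j). h y * p y x = 0"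
    proof
      fix y assume y: "y \<in> below j - insert s (children x \<inter> below j)"
      then have yV: "y \<in> V" "d y < j" "y \<noteq> s" "y \<notin> children x" by (auto simp: below_def)
      have "(y, x) \<notin> E"
      proof
        assume yx: "(y, x) \<in> E"
        then have "d x = Suc (d y)"
          using adjacent_layers[OF yx] yV(4) E_sym[OF yx] by (auto simp: children_def)
        with parent_unique[OF yx E] d yV(3) show False by simp
      qed
      then show "h y * p y x = 0"
        using nearest_neighbor_0[OF p yV(1), of x] yV j E E_in_V by simp
    qed
  qed simp
  also have "\<dots> = h s * p s x + (\<Sum>v\<in>children x \<inter> below j. h v * p v x)"
    using d by (subst sum.insert) (auto simp: children_def)
  finally show ?thesis .
qed

lemma inflow_from_children:
  assumes p: "nearest_neighbor p" and x: "x \<in> V" and d: "d x < L"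
    and h: "\<And>y. y \<in> V \<Longrightarrow> Suc (d y) = d x \<Longrightarrow> h y = 0"
  shows "(\<Sum>y\<in>below (Suc L). h y * p y x) = (\<Sum>y\<in>children x. h y * p y x)"
proof (rule sum.mono_neutral_right)
  show "children x \<subseteq> below (Suc L)"
    using d by (auto simp: below_def children_def dest: E_in_V)
  show "\<forall>y\<in>below (Suc L) - children x. h y * p y x = 0"
  proof
    fix y assume "y \<in> below (Suc L) - children x"
    then have y: "y \<in> V" "d y \<le> L" "y \<notin> children x" by (auto simp: below_def)
    show "h y * p y x = 0"
    proof (cases "(y, x) \<in> E")
      case True
      then have "Suc (d y) = d x"
        using adjacent_layers[OF True] E_sym[OF True] y(3) by (auto simp: children_def)
      with h[OF y(1)] show ?thesis by simp
    qed (use nearest_neighbor_0[OF p y(1,2) x] in simp)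
  qed
qed simp

lemma taboo_nonneg:
  assumes p: "nearest_neighbor p" and j: "j \<le> Suc L"
  shows "x \<in> V \<Longrightarrow> 0 \<le> taboo_prob (below j) p r n x"
proof (induction n arbitrary: x)
  case (Suc n)
  then show ?case
    using j nearest_neighbor_nonneg[OF p] by (auto simp: below_def intro!: sum_nonneg mult_nonneg_nonneg)
qed simp

lemma taboo_early:
  assumes p: "nearest_neighbor p" and j: "j \<le> Suc L"
  shows "x \<in> V \<Longrightarrow> n < d x \<Longrightarrow> taboo_prob (below j) p r n x = 0"
proof (induction n arbitrary: x)
  case 0
  then show ?case using d_eq_0[of x] by auto
next
  case (Suc n)
  have "taboo_prob (below j) p r n y * p y x = 0" if "y \<in> below j" for y
  proof (cases "(y, x) \<in> E")
    case True
    then have "n < d y" using adjacent_layers[OF True] Suc.prems by auto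
    then show ?thesis using Suc.IH that by (simp add: below_def)
  qed (use that nearest_neighbor_0[OF p] Suc.prems j in \<open>auto simp: below_def\<close>)
  then show ?case unfolding taboo_prob.simps by (intro sum.neutral) blast
qed

lemma taboo_pos:
  assumes p: "nearest_neighbor p" and j: "j \<le> Suc L"
  shows "x \<in> V \<Longrightarrow> d x = n \<Longrightarrow> n \<le> j \<Longrightarrow> 0 < taboo_prob (below j) p r n x"
proof (induction n arbitrary: x)
  case 0
  then show ?case using d_eq_0[of x] by auto
next
  case (Suc n)
  then have "x \<noteq> r" using d_eq_0[of x] by auto
  then obtain s where s: "(s, x) \<in> E" "d x = Suc (d s)" using parent_exists Suc.prems by blast
  have "0 < taboo_prob (below j) p r n s * p s x"
    using Suc s E_in_V nearest_neighbor_pos[OF p s(1)] j by (intro mult_pos_pos) auto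
  moreover have "s \<in> below j" using s Suc.prems E_in_V by (auto simp: below_def)
  moreover have "0 \<le> taboo_prob (below j) p r n y * p y x" if "y \<in> below j" for y
    using that Suc.prems taboo_nonneg[OF p j] nearest_neighbor_nonneg[OF p] j
    by (auto simp: below_def intro!: mult_nonneg_nonneg)
  ultimately have "0 < (\<Sum>y\<in>below j. taboo_prob (below j) p r n y * p y x)"
    by (intro sum_pos2) auto
  then show ?case by simp
qed

text \<open>
  Above depth \<open>L\<close> both taboo probabilities obey the same recursion, hence so does their difference.
\<close>

lemma late_prob_Suc:
  assumes "d x < L"
  shows "late_prob p (Suc n) x = (\<Sum>y\<in>below (Suc L). late_prob p n y * p y x)"
proof -
  have "(\<Sum>y\<in>below L. taboo_prob (below L) p r n y * p y x) =
        (\<Sum>y\<in>below (Suc L). (if d y < L then taboo_prob (below L) p r n y else 0) * p y x)"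
    by (rule sum.mono_neutral_cong_left[OF finite_below]) (auto simp: below_def)
  then show ?thesis
    using assms by (simp add: late_prob_def left_diff_distrib sum_subtractf)
qed

text \<open>
  A walk from the root to depth \<open>L\<close> and back up to \<open>x\<close> takes at least \<open>L + (L - d x)\<close> steps.
\<close>

lemma late_prob_early:
  assumes p: "nearest_neighbor p" and L: "0 < L"
  shows "x \<in> V \<Longrightarrow> d x \<le> L \<Longrightarrow> n + d x < 2 * L \<Longrightarrow> late_prob p n x = 0"
proof (induction n arbitrary: x)
  case 0
  then show ?case using L d_eq_0[of x] by (auto simp: late_prob_def)
next
  case (Suc n)
  show ?case
  proof (cases "d x < L")
    case True
    have "late_prob p n y * p y x = 0" if "y \<in> below (Suc L)" for y
    proof (cases "(y, x) \<in> E")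
      case yx: True
      then have "n + d y < 2 * L" using adjacent_layers[OF yx] Suc.prems by auto
      then show ?thesis using Suc.IH that by (simp add: below_def)
    qed (use that nearest_neighbor_0[OF p] Suc.prems in \<open>auto simp: below_def\<close>)
    then show ?thesis unfolding late_prob_Suc[OF True] by (intro sum.neutral) blast
  next
    case False
    then have "Suc n < d x" using Suc.prems by simp
    then show ?thesis
      using False taboo_early[OF p order_refl] Suc.prems by (simp add: late_prob_def del: taboo_prob.simps)
  qed
qed

text \<open>
  At the first possible time \<open>2 * L - d x\<close> the walk is on its way back from depth \<open>L\<close>, so it enters
  \<open>x\<close> from a child.  Hence this value involves only transition probabilities at vertices below \<open>x\<close> and
  the late probabilities there.
\<close>

lemma late_prob_first:
  assumes p: "nearest_neighbor p" and x: "x \<in> V" "d x < L" and n: "Suc n + d x = 2 * L"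
  shows "late_prob p (Suc n) x = (\<Sum>y\<in>children x. late_prob p n y * p y x)"
proof -
  have "late_prob p n y = 0" if "y \<in> V" "Suc (d y) = d x" for y
    using that n x by (intro late_prob_early[OF p]) auto
  then show ?thesis
    using late_prob_Suc[OF x(2)] inflow_from_children[OF p x, of "late_prob p n"] by simp
qed

text \<open>
  Going straight down to depth \<open>L\<close> and straight back has positive probability, as every vertex
  of depth less than \<open>L\<close> has a child.
\<close>

lemma late_prob_pos:
  assumes p: "nearest_neighbor p"
  shows "x \<in> V \<Longrightarrow> d x \<le> L \<Longrightarrow> n + d x = 2 * L \<Longrightarrow> 0 < late_prob p n x"
proof (induction "L - d x" arbitrary: x n)
  case 0
  then have "d x = L" "n = L" by auto
  then show ?case using taboo_pos[OF p order_refl 0(2), of L] by (simp add: late_prob_def)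
next
  case (Suc m)
  then have dx: "d x < L" by simp
  then obtain k where n: "n = Suc k" using Suc.prems by (cases n) auto
  have "children x \<noteq> {}" using child_exists[OF Suc.prems(1,2)] by (auto simp: children_def)
  moreover have "0 < late_prob p k y * p y x" if y: "y \<in> children x" for y
  proof -
    have "(y, x) \<in> E" "d y = Suc (d x)" using y E_sym by (auto simp: children_def)
    then show ?thesis
      using Suc.hyps Suc.prems n dx E_in_V nearest_neighbor_pos[OF p] by (intro mult_pos_pos) auto
  qed
  ultimately have "0 < (\<Sum>y\<in>children x. late_prob p k y * p y x)" by (intro sum_pos) auto
  then show ?case using late_prob_first[OF p Suc.prems(1) dx] Suc.prems n by simp
qed

text \<open>
  The probability of stepping to the parent is what the children leave over from \<open>1\<close>.
\<close>

lemma eq_if_eq_on_children: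
  assumes p: "nearest_neighbor p" "nearest_neighbor q" and s: "s \<in> V" "d s \<le> L"
    and eq: "\<And>u. u \<in> children s \<Longrightarrow> p s u = q s u" and y: "y \<in> V"
  shows "p s y = q s y"
proof (cases "(s, y) \<in> E \<and> y \<notin> children s")
  case True
  then have up: "d s = Suc (d y)" using adjacent_layers by (auto simp: children_def)
  have N: "{y. (s, y) \<in> E} = insert y (children s)"
  proof (intro set_eqI iffI)
    fix z assume z: "z \<in> {y. (s, y) \<in> E}"
    show "z \<in> insert y (children s)"
    proof (cases "d z = Suc (d s)")
      case False
      then have "d s = Suc (d z)" using adjacent_layers z by blast
      then have "z = y" using parent_unique[of z s y] z True up E_sym by blast
      then show ?thesis by simp
    qed (use z in \<open>simp add: children_def\<close>)
  qed (use True in \<open>auto simp: children_def\<close>)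
  have "(\<Sum>y | (s, y) \<in> E. p s y) = 1" "(\<Sum>y | (s, y) \<in> E. q s y) = 1"
    using p s unfolding nearest_neighbor_def by auto
  then have "p s y + sum (p s) (children s) = q s y + sum (q s) (children s)"
    unfolding N using True by simp
  then show ?thesis using eq by simp
next
  case False
  then consider "y \<in> children s" | "(s, y) \<notin> E" by blast
  then show ?thesis
    using eq nearest_neighbor_0[OF p(1) s y] nearest_neighbor_0[OF p(2) s y] by cases auto
qed

text \<open>
  The inversion.  Besides the transition probabilities at \<open>x\<close> the claim includes both families of taboo
  probabilities at \<open>x\<close>, since these are what the induction hands from the children to their parent.
  For a child \<open>u\<close> of \<open>s\<close>, subtracting the known inflow from below gives \<open>p s u\<close> times each taboo
  probability at \<open>s\<close>, hence \<open>p s u\<close> times each late probability at \<open>s\<close>.  One of these late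
  probabilities is known and positive by \<open>late_prob_first\<close> and \<open>late_prob_pos\<close>, and dividing by it gives \<open>p s u\<close>.
\<close>

lemma nearest_neighbor_determined:
  assumes p: "nearest_neighbor p" and q: "nearest_neighbor q"
    and W: "\<And>x y. x \<in> V \<Longrightarrow> d x = L \<Longrightarrow> y \<in> V \<Longrightarrow> p x y = q x y"
    and outer: "\<And>n x. x \<in> V \<Longrightarrow> d x = Suc L \<Longrightarrow>
      taboo_prob (below (Suc L)) p r n x = taboo_prob (below (Suc L)) q r n x"
    and inner: "\<And>n x. x \<in> V \<Longrightarrow> d x = L \<Longrightarrow>
      taboo_prob (below L) p r n x = taboo_prob (below L) q r n x"
    and x: "x \<in> V" "d x \<le> L"
  shows "(\<forall>y\<in>V. p x y = q x y) \<and>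
     (\<forall>n. taboo_prob (below (Suc L)) p r n x = taboo_prob (below (Suc L)) q r n x) \<and>
     (\<forall>n. taboo_prob (below L) p r n x = taboo_prob (below L) q r n x)"
  using x
proof (induction "L - d x" arbitrary: x rule: less_induct)
  case (less s)
  have IH: "\<forall>y\<in>V. p v y = q v y"
      "taboo_prob (below (Suc L)) p r n v = taboo_prob (below (Suc L)) q r n v"
      "taboo_prob (below L) p r n v = taboo_prob (below L) q r n v"
    if "v \<in> V" "d v \<le> L" "d s < d v" for v n
    using less.hyps[of v] that by auto
  have flow: "p s u * taboo_prob (below j) p r n s = q s u * taboo_prob (below j) q r n s"
    if u: "u \<in> children s" and j: "d s < j" "j = L \<or> j = Suc L" for u j n
  proof -
    have su: "(s, u) \<in> E" "d u = Suc (d s)" "u \<in> V" using u by (auto simp: children_def E_in_V)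
    have jL: "j \<le> Suc L" using j by auto
    have "taboo_prob (below j) p r (Suc n) u = taboo_prob (below j) q r (Suc n) u"
    proof (cases "d u = j")
      case True
      then show ?thesis
        using j(2) inner[OF su(3), of "Suc n"] outer[OF su(3), of "Suc n"]
        by (auto simp del: taboo_prob.simps)
    next
      case False
      then have "d u \<le> L" "d s < d u" using j su(2) by auto
      then show ?thesis using IH(2,3)[OF su(3), of "Suc n"] j(2)
        by (auto simp del: taboo_prob.simps)
    qed
    moreover have "(\<Sum>v\<in>children u \<inter> below j. taboo_prob (below j) p r n v * p v u) =
        (\<Sum>v\<in>children u \<inter> below j. taboo_prob (below j) q r n v * q v u)"
    proof (rule sum.cong[OF refl])
      fix v assume "v \<in> children u \<inter> below j"
      then have v: "v \<in> V" "d v \<le> L" "d s < d v" using su j by (auto simp: children_def below_def)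
      then show "taboo_prob (below j) p r n v * p v u = taboo_prob (below j) q r n v * q v u"
        using IH[OF v] su(3) j(2) by auto
    qed
    ultimately show ?thesis
      using inflow_split[OF p jL su(1,2) j(1), of "taboo_prob (below j) p r n"]
        inflow_split[OF q jL su(1,2) j(1), of "taboo_prob (below j) q r n"]
      by (simp add: mult.commute)
  qed
  have children_eq: "p s u = q s u" if u: "u \<in> children s" for u
  proof (cases "d s = L")
    case True
    then show ?thesis using W less.prems(1) children_in_V[OF u] by blast
  next
    case False
    then have ds: "d s < L" using less.prems by simp
    \<comment> \<open>\<open>Suc m\<close> is the first time at which the late probability at \<open>s\<close> does not vanish.\<close>
    define m where "m = 2 * L - d s - 1"
    with ds have m: "Suc m + d s = 2 * L" by simp
    have "late_prob p (Suc m) s = late_prob q (Suc m) s"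
      unfolding late_prob_first[OF p less.prems(1) ds m] late_prob_first[OF q less.prems(1) ds m]
    proof (rule sum.cong[OF refl])
      fix v assume "v \<in> children s"
      then have v: "v \<in> V" "d v \<le> L" "d s < d v" using ds children_in_V by (auto simp: children_def)
      then show "late_prob p m v * p v s = late_prob q m v * q v s"
        using IH[OF v] less.prems(1) by (simp add: late_prob_def)
    qed
    moreover have "p s u * late_prob p (Suc m) s = q s u * late_prob q (Suc m) s"
      using flow[OF u, of "Suc L" "Suc m"] flow[OF u, of L "Suc m"] ds
      by (simp add: late_prob_def right_diff_distrib del: taboo_prob.simps)
    moreover have "0 < late_prob p (Suc m) s"
      using late_prob_pos[OF p less.prems] m by simp
    ultimately show ?thesis by simp
  qed
  obtain u where u: "u \<in> children s"
    using child_exists[OF less.prems] by (auto simp: children_def)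
  have pos: "0 < p s u" using u less.prems nearest_neighbor_pos[OF p] by (auto simp: children_def)
  have "taboo_prob (below j) p r n s = taboo_prob (below j) q r n s"
    if "d s < j" "j = L \<or> j = Suc L" for j n
    using flow[OF u that, of n] children_eq[OF u] pos by simp
  then have "taboo_prob (below (Suc L)) p r n s = taboo_prob (below (Suc L)) q r n s"
      "taboo_prob (below L) p r n s = taboo_prob (below L) q r n s" for n
    using less.prems inner by (auto simp: le_less)
  then show ?case
    using eq_if_eq_on_children[OF p q less.prems children_eq] by blast
qed

end

section \<open>Hitting distributions as taboo probabilities\<close>

lemma hitting_time_eq_iff:
  assumes "v \<in> A"
  shows "hitting_time X A \<omega> = enat k \<and> X k \<omega> = Some v \<longleftrightarrow>
     X k \<omega> = Some v \<and> (\<forall>i<k. X i \<omega> \<notin> Some ` A)"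
proof (cases "X k \<omega> = Some v")
  case True
  then have k: "enat k \<in> {enat n | n. X n \<omega> \<in> Some ` A}" using assms by auto
  have "Inf {enat n | n. X n \<omega> \<in> Some ` A} = enat k \<longleftrightarrow> (\<forall>i<k. X i \<omega> \<notin> Some ` A)"
  proof
    assume eq: "Inf {enat n | n. X n \<omega> \<in> Some ` A} = enat k"
    show "\<forall>i<k. X i \<omega> \<notin> Some ` A"
    proof (intro allI impI notI)
      fix i assume "i < k" "X i \<omega> \<in> Some ` A"
      then have "Inf {enat n | n. X n \<omega> \<in> Some ` A} \<le> enat i" by (intro Inf_lower) auto
      with eq \<open>i < k\<close> show False by simp
    qed
  next
    assume "\<forall>i<k. X i \<omega> \<notin> Some ` A"
    then have "enat k \<le> z" if "z \<in> {enat n | n. X n \<omega> \<in> Some ` A}" for z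
      using that by (auto simp: not_less[symmetric])
    with k show "Inf {enat n | n. X n \<omega> \<in> Some ` A} = enat k"
      by (intro antisym Inf_lower Inf_greatest) auto
  qed
  then show ?thesis using True by (simp add: hitting_time_def)
qed simp

text \<open>
  The chain is specified through conditional probabilities given its whole history, so the
  one-step recursion is obtained by summing over the finitely many histories up to time \<open>n\<close> that avoid
  \<open>A\<close>.  Terminal vertices drop out of the recursion because the chain leaves them for the cemetery.
\<close>

lemma hitting_distribution_eq_taboo_prob:
  assumes chain: "nondegenerate_simple_chain G t x0 M X" and fin: "finite (pverts G)"
    and A: "A \<subseteq> pverts G" and v: "v \<in> A"
  shows "hitting_distribution M X A k v = taboo_prob (pverts G - A - terminal_verts G) t x0 k v"
proof -
  interpret prob_space M using chain by (simp add: nondegenerate_simple_chain_def)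
  have meas: "X n \<in> M \<rightarrow>\<^sub>M count_space (states G)" for n
    using chain by (simp add: nondegenerate_simple_chain_def)
  have X_states: "X n \<omega> \<in> states G" if "\<omega> \<in> space M" for n \<omega>
    using measurable_space[OF meas that] by simp
  have ev1: "{\<omega> \<in> space M. P (X n \<omega>)} \<in> events" for P n
  proof -
    have "{\<omega> \<in> space M. P (X n \<omega>)} = X n -` {z \<in> states G. P z} \<inter> space M"
      using X_states by auto
    then show ?thesis using measurable_sets[OF meas, of "{z \<in> states G. P z}" n] by simp
  qed
  have ev_le: "{\<omega> \<in> space M. \<forall>i\<le>n. P i (X i \<omega>)} \<in> events" for P and n :: nat
  proof -
    have "{\<omega> \<in> space M. \<forall>i\<in>{..n}. P i (X i \<omega>)} \<in> events"
      by (rule sets.sets_Collect_finite_All[OF ev1[of "P i" i for i]]) simp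
    then show ?thesis unfolding Ball_def atMost_iff .
  qed
  have ev_less: "{\<omega> \<in> space M. \<forall>i<n. P i (X i \<omega>)} \<in> events" for P and n :: nat
  proof -
    have "{\<omega> \<in> space M. \<forall>i\<in>{..<n}. P i (X i \<omega>)} \<in> events"
      by (rule sets.sets_Collect_finite_All[OF ev1[of "P i" i for i]]) simp
    then show ?thesis unfolding Ball_def lessThan_iff .
  qed
  have fin_states: "finite (states G)" using fin by (simp add: states_def)
  define hist where "hist n = {s \<in> {..n} \<rightarrow>\<^sub>E states G. \<forall>i<n. s i \<notin> Some ` A}" for n :: nat
  define path_prob where "path_prob n s = \<P>(\<omega> in M. \<forall>i\<le>n. X i \<omega> = s i)" for n :: nat and s
  define F where "F n z = \<P>(\<omega> in M. X n \<omega> = z \<and> (\<forall>i<n. X i \<omega> \<notin> Some ` A))" for n z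
  have fin_hist: "finite (hist n)" for n
    unfolding hist_def by (rule finite_subset[OF Collect_restrict]) (simp add: finite_PiE fin_states)
  \<comment> \<open>A sample path follows exactly one history, so the events of the histories form a partition.\<close>
  have restrict_eq: "s = restrict (\<lambda>i. X i \<omega>) {..n}"
    if "s \<in> {..n} \<rightarrow>\<^sub>E states G" "\<forall>i\<le>n. X i \<omega> = s i" for s n \<omega>
  proof (rule ext)
    fix i
    show "s i = restrict (\<lambda>i. X i \<omega>) {..n} i"
      using that(2) PiE_arb[OF that(1), of i] by (cases "i \<le> n") simp_all
  qed
  have restrict_states: "restrict (\<lambda>i. X i \<omega>) {..n} \<in> {..n} \<rightarrow>\<^sub>E states G" if "\<omega> \<in> space M" for \<omega> n
    using X_states[OF that] by (simp add: restrict_PiE_iff)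
  have F_hist: "F n z = (\<Sum>s\<in>{s \<in> hist n. s n = z}. path_prob n s)" if "z \<in> states G" for n z
    unfolding F_def path_prob_def
  proof (rule prob_sum)
    show "finite {s \<in> hist n. s n = z}" using fin_hist by simp
    show "{\<omega> \<in> space M. \<forall>i\<le>n. X i \<omega> = s i} \<in> events" for s
      by (rule ev_le[of n "\<lambda>i y. y = s i"])
    show "{\<omega> \<in> space M. X n \<omega> = z \<and> (\<forall>i<n. X i \<omega> \<notin> Some ` A)} \<in> events"
      by (rule sets.sets_Collect_conj[OF ev_less[of n "\<lambda>i y. y \<notin> Some ` A"] ev1[of "\<lambda>y. y = z"]])
    show "AE \<omega> in M. (\<forall>s\<in>{s \<in> hist n. s n = z}. (\<forall>i\<le>n. X i \<omega> = s i) \<longrightarrow>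
        X n \<omega> = z \<and> (\<forall>i<n. X i \<omega> \<notin> Some ` A)) \<and>
      (X n \<omega> = z \<and> (\<forall>i<n. X i \<omega> \<notin> Some ` A) \<longrightarrow>
        (\<exists>!s. s \<in> {s \<in> hist n. s n = z} \<and> (\<forall>i\<le>n. X i \<omega> = s i)))"
    proof (rule AE_I2, intro conjI impI)
      fix \<omega> assume w: "\<omega> \<in> space M"
      show "\<forall>s\<in>{s \<in> hist n. s n = z}. (\<forall>i\<le>n. X i \<omega> = s i) \<longrightarrow>
          X n \<omega> = z \<and> (\<forall>i<n. X i \<omega> \<notin> Some ` A)"
        by (auto simp: hist_def)
      assume "X n \<omega> = z \<and> (\<forall>i<n. X i \<omega> \<notin> Some ` A)"
      then show "\<exists>!s. s \<in> {s \<in> hist n. s n = z} \<and> (\<forall>i\<le>n. X i \<omega> = s i)"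
        using restrict_states[OF w] restrict_eq
        by (intro ex1I[of _ "restrict (\<lambda>i. X i \<omega>) {..n}"]) (auto simp: hist_def)
    qed
  qed
  have step: "\<P>(\<omega> in M. X (Suc n) \<omega> = z \<and> (\<forall>i\<le>n. X i \<omega> = s i)) =
      path_prob n s * killed_kernel G t (s n) z" if "z \<in> states G" for n s z
  proof (cases "path_prob n s > 0")
    case True
    then have "\<P>(\<omega> in M. X (Suc n) \<omega> = z \<bar> \<forall>i\<le>n. X i \<omega> = s i) = killed_kernel G t (s n) z"
      using chain that unfolding nondegenerate_simple_chain_def path_prob_def by blast
    then show ?thesis
      using True unfolding cond_prob_def path_prob_def by (simp add: field_simps)
  next
    case False
    moreover have "0 \<le> path_prob n s" by (simp add: path_prob_def)
    ultimately have "path_prob n s = 0" by linarith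
    moreover have "\<P>(\<omega> in M. X (Suc n) \<omega> = z \<and> (\<forall>i\<le>n. X i \<omega> = s i)) \<le> path_prob n s"
      unfolding path_prob_def by (intro finite_measure_mono ev_le[of n "\<lambda>i y. y = s i"]) auto
    moreover have "0 \<le> \<P>(\<omega> in M. X (Suc n) \<omega> = z \<and> (\<forall>i\<le>n. X i \<omega> = s i))" by simp
    ultimately show ?thesis by simp
  qed
  have F_Suc: "F (Suc n) z = (\<Sum>y\<in>states G - Some ` A. F n y * killed_kernel G t y z)"
    if z: "z \<in> states G" for n z
  proof -
    define H where "H = {s \<in> hist n. s n \<notin> Some ` A}"
    have "F (Suc n) z = (\<Sum>s\<in>H. \<P>(\<omega> in M. X (Suc n) \<omega> = z \<and> (\<forall>i\<le>n. X i \<omega> = s i)))"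
      unfolding F_def
    proof (rule prob_sum)
      show "finite H" using fin_hist by (simp add: H_def)
      show "{\<omega> \<in> space M. X (Suc n) \<omega> = z \<and> (\<forall>i\<le>n. X i \<omega> = s i)} \<in> events" for s
        by (rule sets.sets_Collect_conj[OF ev_le[of n "\<lambda>i y. y = s i"] ev1[of "\<lambda>y. y = z"]])
      show "{\<omega> \<in> space M. X (Suc n) \<omega> = z \<and> (\<forall>i<Suc n. X i \<omega> \<notin> Some ` A)} \<in> events"
        by (rule sets.sets_Collect_conj[OF ev_less[of "Suc n" "\<lambda>i y. y \<notin> Some ` A"] ev1[of "\<lambda>y. y = z"]])
      show "AE \<omega> in M. (\<forall>s\<in>H. X (Suc n) \<omega> = z \<and> (\<forall>i\<le>n. X i \<omega> = s i) \<longrightarrow>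
          X (Suc n) \<omega> = z \<and> (\<forall>i<Suc n. X i \<omega> \<notin> Some ` A)) \<and>
        (X (Suc n) \<omega> = z \<and> (\<forall>i<Suc n. X i \<omega> \<notin> Some ` A) \<longrightarrow>
          (\<exists>!s. s \<in> H \<and> X (Suc n) \<omega> = z \<and> (\<forall>i\<le>n. X i \<omega> = s i)))"
      proof (rule AE_I2, intro conjI impI)
        fix \<omega> assume w: "\<omega> \<in> space M"
        show "\<forall>s\<in>H. X (Suc n) \<omega> = z \<and> (\<forall>i\<le>n. X i \<omega> = s i) \<longrightarrow>
            X (Suc n) \<omega> = z \<and> (\<forall>i<Suc n. X i \<omega> \<notin> Some ` A)"
          by (auto simp: H_def hist_def less_Suc_eq)
        assume "X (Suc n) \<omega> = z \<and> (\<forall>i<Suc n. X i \<omega> \<notin> Some ` A)"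
        then show "\<exists>!s. s \<in> H \<and> X (Suc n) \<omega> = z \<and> (\<forall>i\<le>n. X i \<omega> = s i)"
          using restrict_states[OF w] restrict_eq
          by (intro ex1I[of _ "restrict (\<lambda>i. X i \<omega>) {..n}"]) (auto simp: H_def hist_def)
      qed
    qed
    also have "\<dots> = (\<Sum>s\<in>H. path_prob n s * killed_kernel G t (s n) z)"
      using step[OF z] by simp
    also have "\<dots> = (\<Sum>y\<in>states G - Some ` A. \<Sum>s\<in>{s \<in> H. s n = y}. path_prob n s * killed_kernel G t (s n) z)"
    proof (rule sum.group[symmetric])
      show "finite H" using fin_hist by (simp add: H_def)
      show "(\<lambda>s. s n) ` H \<subseteq> states G - Some ` A" by (auto simp: H_def hist_def)
    qed (use fin_states in simp)
    also have "\<dots> = (\<Sum>y\<in>states G - Some ` A. F n y * killed_kernel G t y z)"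
    proof (rule sum.cong[OF refl])
      fix y assume y: "y \<in> states G - Some ` A"
      then have "{s \<in> H. s n = y} = {s \<in> hist n. s n = y}" by (auto simp: H_def)
      then show "(\<Sum>s\<in>{s \<in> H. s n = y}. path_prob n s * killed_kernel G t (s n) z) =
          F n y * killed_kernel G t y z"
        using F_hist[of y n] y by (simp add: sum_distrib_right)
    qed
    finally show ?thesis .
  qed
  have "F n (Some x) = taboo_prob (pverts G - A - terminal_verts G) t x0 n x" if "x \<in> pverts G" for n x
    using that
  proof (induction n arbitrary: x)
    case 0
    have ae: "AE \<omega> in M. X 0 \<omega> = Some x0" using chain by (simp add: nondegenerate_simple_chain_def)
    have "F 0 (Some x) = \<P>(\<omega> in M. x = x0)"
      unfolding F_def using ae using ev1[of "\<lambda>y. y = Some x" 0] by (intro prob_eq_AE) auto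
    then show ?case using prob_space by simp
  next
    case (Suc n)
    let ?S = "pverts G - A - terminal_verts G"
    have "F (Suc n) (Some x) = (\<Sum>y\<in>states G - Some ` A. F n y * killed_kernel G t y (Some x))"
      using Suc.prems by (intro F_Suc) (simp add: states_def)
    also have "\<dots> = (\<Sum>y\<in>Some ` ?S. F n y * killed_kernel G t y (Some x))"
    proof (rule sum.mono_neutral_right)
      show "\<forall>y\<in>states G - Some ` A - Some ` ?S. F n y * killed_kernel G t y (Some x) = 0"
        by (auto simp: states_def)
    qed (use fin_states in \<open>auto simp: states_def\<close>)
    also have "\<dots> = (\<Sum>y\<in>?S. F n (Some y) * killed_kernel G t (Some y) (Some x))"
      by (subst sum.reindex) (auto simp: inj_on_def)
    also have "\<dots> = (\<Sum>y\<in>?S. taboo_prob ?S t x0 n y * t y x)"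
      using Suc.IH by (intro sum.cong) auto
    finally show ?case by simp
  qed
  then have "F k (Some v) = taboo_prob (pverts G - A - terminal_verts G) t x0 k v"
    using A v by blast
  then show ?thesis
    unfolding hitting_distribution_def F_def hitting_time_eq_iff[OF v] .
qed

section \<open>Depth in a rooted tree\<close>

lemma awalk_with_proj_iff:
  "pre_digraph.awalk (with_proj G) u p v \<longleftrightarrow> u \<in> pverts G \<and> set p \<subseteq> parcs G \<and> pcas u p v"
  by (simp add: pre_digraph.awalk_def cas_with_proj_eq)

text \<open>
  A function that decreases by at most one along each arc bounds the length of walks to \<open>r\<close> from
  below; if it can always be decreased by one, some walk attains the bound.
\<close>

lemma graph_dist_eqI:
  fixes \<delta> :: "'v \<Rightarrow> nat"
  assumes wf: "parcs G \<subseteq> pverts G \<times> pverts G"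
    and root: "\<delta> r = 0"
    and Lip: "\<And>x y. (x, y) \<in> parcs G \<Longrightarrow> \<delta> x \<le> Suc (\<delta> y)"
    and descend: "\<And>x. x \<in> pverts G \<Longrightarrow> x \<noteq> r \<Longrightarrow> \<exists>y. (x, y) \<in> parcs G \<and> \<delta> x = Suc (\<delta> y)"
    and x: "x \<in> pverts G"
  shows "graph_dist G x r = \<delta> x"
  unfolding graph_dist_def awalk_with_proj_iff
proof (rule Least_equality)
  show "\<exists>p. (x \<in> pverts G \<and> set p \<subseteq> parcs G \<and> pcas x p r) \<and> length p = \<delta> x"
    using x
  proof (induction "\<delta> x" arbitrary: x)
    case 0
    then have "x = r" using descend[of x] by auto
    then show ?case using 0 by (intro exI[of _ "[]"]) auto
  next
    case (Suc m)
    then have "x \<noteq> r" using root by auto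
    then obtain y where y: "(x, y) \<in> parcs G" "\<delta> x = Suc (\<delta> y)" using descend Suc.prems by blast
    then obtain p where "set p \<subseteq> parcs G" "pcas y p r" "length p = \<delta> y"
      using Suc.hyps(1)[of y] Suc.hyps(2) wf by auto
    then show ?case using y Suc.prems by (intro exI[of _ "(x, y) # p"]) auto
  qed
next
  have "\<delta> u \<le> length p" if "set p \<subseteq> parcs G" "pcas u p r" for u p
    using that
  proof (induction p arbitrary: u)
    case (Cons e p)
    then have "(u, snd e) \<in> parcs G" "\<delta> (snd e) \<le> length p" by auto
    then show ?case using Lip by force
  qed (simp add: root)
  then show "\<delta> x \<le> k" if "\<exists>p. (x \<in> pverts G \<and> set p \<subseteq> parcs G \<and> pcas x p r) \<and> length p = k" for k
    using that by blast
qed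

lemma pawalk_verts_conv: "pcas a q b \<Longrightarrow> pawalk_verts a q = map fst q @ [b]"
  by (induction q arbitrary: a) auto

locale rooted_tree =
  fixes G :: "'a pair_pre_digraph" and r :: 'a
  assumes tree: "finite_rooted_tree G r"
begin

sublocale pair_graph G
  using tree by (simp add: finite_rooted_tree_def)

abbreviation depth :: "'a \<Rightarrow> nat" where
  "depth v \<equiv> graph_dist G v r"

lemma root_in_verts: "r \<in> pverts G"
  using tree by (simp add: finite_rooted_tree_def)

lemma arcs_symmetric: "(x, y) \<in> parcs G \<Longrightarrow> (y, x) \<in> parcs G"
  using pair_sym_arcs by (auto simp: symmetric_def sym_def)

lemma awalk_exists:
  assumes "x \<in> pverts G" "y \<in> pverts G"
  shows "\<exists>p. awalk x p y"
proof -
  have "strongly_connected (with_proj G)"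
    using tree by (intro symmetric_connected_imp_strongly_connected pair_sym_arcs)
      (simp add: finite_rooted_tree_def)
  then show ?thesis using assms by (simp add: strongly_connected_def reachable_awalk)
qed

lemma depth_le_length: "awalk x p r \<Longrightarrow> depth x \<le> length p"
  unfolding graph_dist_def by (rule Least_le) auto

lemma shortest_awalk:
  assumes "x \<in> pverts G"
  obtains p where "awalk x p r" "length p = depth x"
proof -
  have "\<exists>n p. awalk x p r \<and> length p = n" using awalk_exists[OF assms root_in_verts] by blast
  then have "\<exists>p. awalk x p r \<and> length p = depth x"
    unfolding graph_dist_def by (rule LeastI_ex)
  then show ?thesis using that by blast
qed

lemma depth_root: "depth r = 0"
  using depth_le_length[of r "[]"] root_in_verts by (simp add: awalk_with_proj_iff)

lemma depth_arc_le:
  assumes "(x, y) \<in> parcs G"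
  shows "depth x \<le> Suc (depth y)"
proof -
  have xy: "x \<in> pverts G" "y \<in> pverts G" using assms by (auto dest: wellformed')
  obtain p where "awalk y p r" "length p = depth y" using shortest_awalk[OF xy(2)] .
  then have "awalk x ((x, y) # p) r"
    using assms xy by (simp add: awalk_with_proj_iff)
  from depth_le_length[OF this] \<open>length p = depth y\<close> show ?thesis by simp
qed

lemma parent_exists:
  assumes x: "x \<in> pverts G" "x \<noteq> r"
  obtains y where "(x, y) \<in> parcs G" "depth x = Suc (depth y)"
proof -
  obtain p where p: "awalk x p r" "length p = depth x" using shortest_awalk[OF x(1)] .
  then obtain e q where q: "p = e # q" using x(2) by (cases p) (auto simp: awalk_with_proj_iff)
  with p have e: "(x, snd e) \<in> parcs G" and "awalk (snd e) q r"
    by (auto simp: awalk_with_proj_iff dest: wellformed')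
  then have "depth (snd e) \<le> length q" using depth_le_length by blast
  then have "depth x = Suc (depth (snd e))" using depth_arc_le[OF e] p q by simp
  with e show ?thesis using that by blast
qed

text \<open>
  This is where acyclicity enters.  Shortest walks from \<open>a\<close> and \<open>b\<close> to the root avoid \<open>u\<close>, so if
  \<open>a\<close> and \<open>b\<close> were distinct, a path between them avoiding \<open>u\<close> would close up through \<open>u\<close> to a
  cycle of length at least 3.
\<close>

lemma lower_neighbor_unique:
  assumes a: "(u, a) \<in> parcs G" "depth a \<le> depth u" and b: "(u, b) \<in> parcs G" "depth b \<le> depth u"
  shows "a = b"
proof (rule ccontr)
  assume ab: "a \<noteq> b"
  \<comment> \<open>The arcs of the graph with \<open>u\<close> removed.\<close>
  define E' where "E' = {(x, y) \<in> parcs G. x \<noteq> u \<and> y \<noteq> u}"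
  have to_root: "(x, r) \<in> E'\<^sup>*" if "x \<in> pverts G" "x \<noteq> u" "depth x \<le> depth u" for x
    using that
  proof (induction "depth x" arbitrary: x rule: less_induct)
    case less
    show ?case
    proof (cases "x = r")
      case False
      then obtain y where y: "(x, y) \<in> parcs G" "depth x = Suc (depth y)"
        using parent_exists less.prems by blast
      then have "(x, y) \<in> E'" using less.prems by (auto simp: E'_def)
      moreover have "(y, r) \<in> E'\<^sup>*" using less y by (intro less.hyps) (auto dest: wellformed')
      ultimately show ?thesis by (rule converse_rtrancl_into_rtrancl)
    qed simp
  qed
  have "sym (E'\<^sup>*)" using arcs_symmetric by (intro sym_rtrancl) (auto simp: sym_def E'_def)
  moreover have "a \<noteq> u" "b \<noteq> u" "a \<in> pverts G" "b \<in> pverts G" "u \<in> pverts G"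
    using a b no_loops' by (auto dest: wellformed')
  ultimately have "(a, b) \<in> E'\<^sup>*"
    using to_root a b by (meson rtrancl_trans symD)
  then obtain p where p: "awalk a p b" "set p \<subseteq> E'"
  proof (induction arbitrary: thesis rule: converse_rtrancl_induct)
    case base
    then show ?case using \<open>b \<in> pverts G\<close> by (auto simp: awalk_with_proj_iff intro: base[of "[]"])
  next
    case (step y z)
    obtain p where "awalk z p b" "set p \<subseteq> E'" using step.IH .
    then show ?case using step.hyps
      by (intro step.prems[of "(y, z) # p"]) (auto simp: awalk_with_proj_iff E'_def dest: wellformed')
  qed
  define q where "q = awalk_to_apath p"
  have q: "apath a q b" "set q \<subseteq> E'"
    using apath_awalk_to_apath[OF p(1)] awalk_to_apath_subset[OF p(1)] p(2) unfolding q_def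
    by (blast, blast)
  then have cas: "pcas a q b" and q_arcs: "set q \<subseteq> parcs G" and dist: "distinct (map fst q @ [b])"
    using pawalk_verts_conv[of a q b] by (simp_all add: apath_def awalk_with_proj_iff)
  have "q \<noteq> []" using cas ab by auto
  define c where "c = (u, a) # q @ [(b, u)]"
  have "pcas a (q @ [(b, u)]) u" using cas by (induction q arbitrary: a) auto
  then have c_walk: "awalk u c u" and c_verts: "pawalk_verts u c = u # map fst q @ [b] @ [u]"
    using a b arcs_symmetric q_arcs \<open>u \<in> pverts G\<close> pawalk_verts_conv[of a "q @ [(b, u)]" u]
    by (auto simp: awalk_with_proj_iff c_def)
  have "u \<notin> fst ` set q" using q(2) by (auto simp: E'_def)
  then have "cycle c"
    unfolding cycle_def using c_walk c_verts dist \<open>b \<noteq> u\<close> by (intro exI[of _ u]) (auto simp: c_def)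
  moreover have "3 \<le> length c" using \<open>q \<noteq> []\<close> by (cases q) (auto simp: c_def)
  ultimately show False using tree by (auto simp: finite_rooted_tree_def)
qed

lemma depth_eq_0: "x \<in> pverts G \<Longrightarrow> depth x = 0 \<longleftrightarrow> x = r"
  using parent_exists depth_root by (metis nat.distinct(1))

lemma adjacent_depths:
  assumes xy: "(x, y) \<in> parcs G"
  shows "depth y = Suc (depth x) \<or> depth x = Suc (depth y)"
proof (rule ccontr)
  assume "\<not> ?thesis"
  then have eq: "depth x = depth y"
    using depth_arc_le[OF xy] depth_arc_le[OF arcs_symmetric[OF xy]] by linarith
  have V: "x \<in> pverts G" "y \<in> pverts G" using xy by (auto dest: wellformed')
  have "x \<noteq> r" using eq depth_eq_0 V depth_root no_loops'[OF xy] by metis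
  then obtain z where z: "(x, z) \<in> parcs G" "depth x = Suc (depth z)" using parent_exists V by blast
  have "z = y" by (rule lower_neighbor_unique[OF z(1) _ xy]) (use z(2) eq in linarith)+
  with z eq show False by simp
qed

lemma depth_le_R_out: "x \<in> pverts G \<Longrightarrow> depth x \<le> R_out G r"
  unfolding R_out_def using pair_finite_verts by (intro Max_ge) auto

text \<open>
  In the one-vertex tree the root has no neighbour, hence is not terminal, but has no child either.
\<close>

lemma child_exists:
  assumes x: "x \<in> pverts G" "x \<notin> terminal_verts G" and nontrivial: "pverts G \<noteq> {r}"
  shows "\<exists>y. (x, y) \<in> parcs G \<and> depth y = Suc (depth x)"
proof (cases "x = r")
  case True
  obtain z where z: "z \<in> pverts G" "z \<noteq> r" using nontrivial root_in_verts by blast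
  obtain p where "awalk r p z" using awalk_exists[OF root_in_verts z(1)] ..
  with z obtain e where "(r, snd e) \<in> parcs G" by (cases p) (auto simp: awalk_with_proj_iff)
  then show ?thesis using adjacent_depths depth_root True by fastforce
next
  case False
  then obtain z where z: "(x, z) \<in> parcs G" "depth x = Suc (depth z)" using parent_exists x by blast
  have "neighbors G x \<noteq> {z}" using x by (auto simp: terminal_verts_def)
  then obtain y where y: "(x, y) \<in> parcs G" "y \<noteq> z" using z by (auto simp: neighbors_def)
  then have "\<not> depth y \<le> depth x" using lower_neighbor_unique z by (metis le_SucI order_refl)
  then show ?thesis using adjacent_depths y(1) by fastforce
qed

end

section \<open>Depth in a spherical augmentation\<close>

context rooted_tree
begin

definition attached_length :: "nat \<Rightarrow> 'a \<Rightarrow> nat" where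
  "attached_length l v = R_out G r - depth v + l"

definition level :: "'a \<times> nat \<Rightarrow> nat" where
  "level x = depth (fst x) + snd x"

abbreviation augmentation :: "nat \<Rightarrow> ('a \<times> nat) pair_pre_digraph" where
  "augmentation \<equiv> spherical_augmentation G r"

lemma pverts_augmentation:
  "(v, i) \<in> pverts (augmentation l) \<longleftrightarrow>
     v \<in> pverts G \<and> (i = 0 \<or> v \<in> terminal_verts G \<and> i \<le> attached_length l v)"
  by (auto simp: spherical_augmentation_def augment_def attached_length_def terminal_verts_def)

lemma parcs_augmentation:
  "((v, i), (w, j)) \<in> parcs (augmentation l) \<longleftrightarrow>
     (v, w) \<in> parcs G \<and> i = 0 \<and> j = 0 \<or>
     v = w \<and> v \<in> terminal_verts G \<and> (j = Suc i \<and> j \<le> attached_length l v \<or> i = Suc j \<and> i \<le> attached_length l v)"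
  by (auto simp: spherical_augmentation_def augment_def attached_length_def)

lemma finite_pverts_augmentation: "finite (pverts (augmentation l))"
proof (rule finite_subset)
  show "pverts (augmentation l) \<subseteq> pverts G \<times> {..R_out G r + l}"
    by (auto simp: pverts_augmentation attached_length_def)
  show "finite (pverts G \<times> {..R_out G r + l})" using pair_finite_verts by simp
qed

lemma parent_in_augmentation:
  assumes "x \<in> pverts (augmentation l)" "x \<noteq> (r, 0)"
  shows "\<exists>y. (y, x) \<in> parcs (augmentation l) \<and> level x = Suc (level y)"
proof -
  obtain v i where x: "x = (v, i)" by (cases x)
  show ?thesis
  proof (cases i)
    case 0
    then have "v \<in> pverts G" "v \<noteq> r" using assms x by (auto simp: pverts_augmentation)
    then obtain w where "(v, w) \<in> parcs G" "depth v = Suc (depth w)" using parent_exists by blast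
    then show ?thesis
      using x 0 arcs_symmetric by (intro exI[of _ "(w, 0)"]) (auto simp: parcs_augmentation level_def)
  next
    case (Suc j)
    then show ?thesis
      using x assms by (intro exI[of _ "(v, j)"]) (auto simp: parcs_augmentation pverts_augmentation level_def)
  qed
qed

text \<open>
  The attached paths compensate exactly for the different depths of the terminal vertices, which
  brings all leaves to depth \<open>R_out G r + l\<close>.
\<close>

lemma layered_tree_augmentation:
  assumes nontrivial: "pverts G \<noteq> {r}"
  shows "layered_tree (pverts (augmentation (Suc m))) (parcs (augmentation (Suc m))) level (r, 0)
    (R_out G r + m)"
proof
  let ?l = "Suc m"
  let ?V = "pverts (augmentation ?l)" and ?E = "parcs (augmentation ?l)"
  show "finite ?V" by (rule finite_pverts_augmentation)
  show "(r, 0) \<in> ?V" using root_in_verts by (simp add: pverts_augmentation)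
  show "?E \<subseteq> ?V \<times> ?V"
    by (auto simp: parcs_augmentation pverts_augmentation terminal_verts_def dest: wellformed')
  show "(y, x) \<in> ?E" if "(x, y) \<in> ?E" for x y
    using that arcs_symmetric by (cases x; cases y) (auto simp: parcs_augmentation)
  show "level x = 0 \<longleftrightarrow> x = (r, 0)" if "x \<in> ?V" for x
    using that depth_eq_0 by (cases x) (auto simp: level_def pverts_augmentation)
  show "level x \<le> Suc (R_out G r + m)" if "x \<in> ?V" for x
    using that depth_le_R_out[of "fst x"]
    by (cases x) (auto simp: level_def pverts_augmentation attached_length_def)
  show "level y = Suc (level x) \<or> level x = Suc (level y)" if "(x, y) \<in> ?E" for x y
    using that by (cases x; cases y) (auto simp: parcs_augmentation level_def dest: adjacent_depths)
  show "\<exists>y. (y, x) \<in> ?E \<and> level x = Suc (level y)" if "x \<in> ?V" "x \<noteq> (r, 0)" for x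
    using parent_in_augmentation that .
  show "y = z"
    if y: "(y, x) \<in> ?E" "level x = Suc (level y)" and z: "(z, x) \<in> ?E" "level x = Suc (level z)"
    for x y z
  proof -
    obtain v i a j b k where eq: "x = (v, i)" "y = (a, j)" "z = (b, k)" by (cases x, cases y, cases z)
    show ?thesis
    proof (cases i)
      case 0
      then have "(v, a) \<in> parcs G" "(v, b) \<in> parcs G" "j = 0" "k = 0"
        using y z eq arcs_symmetric by (auto simp: parcs_augmentation level_def)
      moreover from this have "a = b"
        using y z eq 0 by (intro lower_neighbor_unique[of v]) (auto simp: level_def)
      ultimately show ?thesis using eq by simp
    next
      case (Suc i')
      then show ?thesis using y z eq by (auto simp: parcs_augmentation level_def)
    qed
  qed
  show "\<exists>y. (x, y) \<in> ?E \<and> level y = Suc (level x)" if "x \<in> ?V" "level x \<le> R_out G r + m" for x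
  proof -
    obtain v i where x: "x = (v, i)" by (cases x)
    show ?thesis
    proof (cases "v \<in> terminal_verts G")
      case True
      then have "Suc i \<le> attached_length ?l v"
        using that x depth_le_R_out[of v] by (auto simp: level_def attached_length_def terminal_verts_def)
      then show ?thesis
        using x True by (intro exI[of _ "(v, Suc i)"]) (auto simp: parcs_augmentation level_def)
    next
      case False
      then have "v \<in> pverts G" "i = 0" using that x by (auto simp: pverts_augmentation)
      moreover then obtain w where "(v, w) \<in> parcs G" "depth w = Suc (depth v)"
        using child_exists False nontrivial by blast
      ultimately show ?thesis
        using x by (intro exI[of _ "(w, 0)"]) (auto simp: parcs_augmentation level_def)
    qed
  qed
qed

text \<open>
  If the root is terminal in the original tree, it receives an attached path of its own and thereby
  a second neighbour.
\<close>

lemma root_branches: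
  assumes nontrivial: "pverts G \<noteq> {r}"
  shows "card {y. ((r, 0), y) \<in> parcs (augmentation (Suc m))} \<noteq> 1"
proof (cases "r \<in> terminal_verts G")
  case True
  then obtain w where "neighbors G r = {w}"
    unfolding terminal_verts_def by (auto simp: card_1_singleton_iff)
  then have "((r, 0), (w, 0)) \<in> parcs (augmentation (Suc m))"
    by (auto simp: parcs_augmentation neighbors_def)
  moreover have "((r, 0), (r, Suc 0)) \<in> parcs (augmentation (Suc m))"
    using True by (simp add: parcs_augmentation attached_length_def)
  ultimately show ?thesis
    unfolding card_1_singleton_iff One_nat_def by (metis mem_Collect_eq n_not_Suc_n prod.inject singletonD)
next
  case False
  then have "{y. ((r, 0), y) \<in> parcs (augmentation (Suc m))} = (\<lambda>w. (w, 0)) ` neighbors G r"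
    by (auto simp: parcs_augmentation neighbors_def)
  then show ?thesis
    using False root_in_verts by (simp add: card_image inj_on_def terminal_verts_def)
qed

lemma graph_dist_augmentation:
  assumes nontrivial: "pverts G \<noteq> {r}" and x: "x \<in> pverts (augmentation (Suc m))"
  shows "graph_dist (augmentation (Suc m)) x (r, 0) = level x"
proof -
  interpret H: layered_tree "pverts (augmentation (Suc m))" "parcs (augmentation (Suc m))" level
    "(r, 0)" "R_out G r + m"
    using nontrivial by (rule layered_tree_augmentation)
  show ?thesis
  proof (rule graph_dist_eqI)
    show "level (r, 0) = 0" using H.d_eq_0[OF H.r_in_V] by simp
    show "level x \<le> Suc (level y)" if "(x, y) \<in> parcs (augmentation (Suc m))" for x y
      using H.adjacent_layers[OF that] by auto
    show "\<exists>y. (x, y) \<in> parcs (augmentation (Suc m)) \<and> level x = Suc (level y)"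
      if "x \<in> pverts (augmentation (Suc m))" "x \<noteq> (r, 0)" for x
      using H.parent_exists[OF that] H.E_sym by blast
  qed (use H.E_sub x in auto)
qed

lemma R_out_augmentation:
  assumes nontrivial: "pverts G \<noteq> {r}"
  shows "R_out (augmentation (Suc m)) (r, 0) = Suc (R_out G r + m)"
proof -
  interpret H: layered_tree "pverts (augmentation (Suc m))" "parcs (augmentation (Suc m))" level
    "(r, 0)" "R_out G r + m"
    using nontrivial by (rule layered_tree_augmentation)
  have "(\<lambda>x. graph_dist (augmentation (Suc m)) x (r, 0)) ` pverts (augmentation (Suc m)) =
      level ` pverts (augmentation (Suc m))"
    using graph_dist_augmentation[OF nontrivial] by (intro image_cong) auto
  moreover have "Max (level ` pverts (augmentation (Suc m))) = Suc (R_out G r + m)"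
  proof (rule Max_eqI)
    obtain x where "x \<in> pverts (augmentation (Suc m))" "level x = Suc (R_out G r + m)"
      using H.deepest_exists by blast
    then show "Suc (R_out G r + m) \<in> level ` pverts (augmentation (Suc m))" by (metis imageI)
  qed (use H.d_bound H.finite_V in auto)
  ultimately show ?thesis by (simp add: R_out_def)
qed

lemma terminal_verts_augmentation:
  assumes nontrivial: "pverts G \<noteq> {r}"
  shows "terminal_verts (augmentation (Suc m)) =
    {x \<in> pverts (augmentation (Suc m)). level x = Suc (R_out G r + m)}"
proof -
  interpret H: layered_tree "pverts (augmentation (Suc m))" "parcs (augmentation (Suc m))" level
    "(r, 0)" "R_out G r + m"
    using nontrivial by (rule layered_tree_augmentation)
  show ?thesis
    unfolding terminal_verts_def neighbors_def
    using H.single_neighbor_iff[OF root_branches[OF nontrivial]] by auto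
qed

lemma shell_augmentation:
  assumes nontrivial: "pverts G \<noteq> {r}"
  shows "shell (augmentation (Suc m)) (r, 0) k = {x \<in> pverts (augmentation (Suc m)). level x = k}"
  using graph_dist_augmentation[OF nontrivial] by (auto simp: shell_def)

text \<open>
  The one-vertex tree has no terminal vertex, so nothing is attached to it, and probabilities over
  the empty set of neighbours of its root cannot sum to \<open>1\<close>.
\<close>

lemma nontrivial_if_nondegenerate:
  assumes "nondegenerate_simple (augmentation l) t"
  shows "pverts G \<noteq> {r}"
proof
  assume triv: "pverts G = {r}"
  then have no_arcs: "(v, w) \<notin> parcs G" for v w
    using no_loops'[of v w] in_arcsD1[of v w] in_arcsD2[of v w] by auto
  then have "neighbors G r = {}" by (simp add: neighbors_def)
  then have "r \<notin> terminal_verts G" by (simp add: terminal_verts_def)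
  then have N: "neighbors (augmentation l) (r, 0) = {}"
    using no_arcs by (auto simp: neighbors_def parcs_augmentation)
  then have "(r, 0) \<in> pverts (augmentation l) - terminal_verts (augmentation l)"
    using root_in_verts by (auto simp: pverts_augmentation terminal_verts_def)
  then have "(\<Sum>y\<in>neighbors (augmentation l) (r, 0). t (r, 0) y) = 1"
    using assms unfolding nondegenerate_simple_def by blast
  then show False using N by simp
qed

end

section \<open>Determination by spherical hitting times\<close>

theorem theorem2p4:
  fixes G :: "'a pair_pre_digraph" and r :: 'a
    and t :: "'a \<times> nat \<Rightarrow> 'a \<times> nat \<Rightarrow> real"
    and M :: "'w measure" and X :: "nat \<Rightarrow> 'w \<Rightarrow> ('a \<times> nat) option"
  assumes "finite_rooted_tree G r"
    and "nondegenerate_simple_chain (spherical_augmentation G r 2) t (r, 0) M X"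
  shows "determined_by_spherical_hitting_times TYPE('u) G r 2 t M X"
proof -
  interpret rooted_tree G r using assms(1) by (rule rooted_tree.intro)
  let ?H = "spherical_augmentation G r (Suc (Suc 0))" and ?r = "(r, 0 :: nat)"
  let ?L = "R_out G r + Suc 0"
  have two: "(2 :: nat) = Suc (Suc 0)" by simp
  have t_chain: "nondegenerate_simple_chain ?H t ?r M X" using assms(2) unfolding two .
  then have nontrivial: "pverts G \<noteq> {r}"
    using nontrivial_if_nondegenerate by (auto simp: nondegenerate_simple_chain_def)
  interpret H: layered_tree "pverts ?H" "parcs ?H" level ?r ?L
    using nontrivial by (rule layered_tree_augmentation)
  have leaves: "terminal_verts ?H = {x \<in> pverts ?H. level x = Suc ?L}"
    using nontrivial by (rule terminal_verts_augmentation)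
  have shell: "shell ?H ?r k = {x \<in> pverts ?H. level x = k}" for k
    using nontrivial by (rule shell_augmentation)
  have R: "R_out ?H ?r = Suc ?L" using nontrivial by (rule R_out_augmentation)
  have nearest_neighbor: "H.nearest_neighbor p" if "nondegenerate_simple ?H p" for p
    unfolding H.nearest_neighbor_def
  proof (intro ballI impI)
    fix x assume "x \<in> pverts ?H" "level x \<le> ?L"
    then have "x \<in> pverts ?H - terminal_verts ?H" unfolding leaves by simp
    with that show "(\<forall>y\<in>pverts ?H. 0 \<le> p x y \<and> (0 < p x y \<longleftrightarrow> (x, y) \<in> parcs ?H)) \<and>
        (\<Sum>y | (x, y) \<in> parcs ?H. p x y) = 1"
      unfolding nondegenerate_simple_def neighbors_def by blast
  qed
  have outer_live: "pverts ?H - shell ?H ?r (Suc ?L) - terminal_verts ?H = H.below (Suc ?L)"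
    unfolding H.below_def shell leaves using H.d_bound by force
  have inner_live: "pverts ?H - shell ?H ?r ?L - terminal_verts ?H = H.below ?L"
    unfolding H.below_def shell leaves using H.d_bound by force
  have shell_sub: "shell ?H ?r k \<subseteq> pverts ?H" for k by (auto simp: shell)
  have "u x y = t x y"
    if u_chain: "nondegenerate_simple_chain ?H u ?r N Y"
      and W: "\<forall>x\<in>pverts ?H - original_verts G - terminal_verts ?H. \<forall>y\<in>pverts ?H. u x y = t x y"
      and out: "\<forall>k. \<forall>v\<in>shell ?H ?r (Suc ?L). hitting_distribution N Y (shell ?H ?r (Suc ?L)) k v =
        hitting_distribution M X (shell ?H ?r (Suc ?L)) k v"
      and inn: "\<forall>k. \<forall>v\<in>shell ?H ?r ?L. hitting_distribution N Y (shell ?H ?r ?L) k v =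
        hitting_distribution M X (shell ?H ?r ?L) k v"
      and x: "x \<in> original_verts G" and y: "y \<in> pverts ?H"
    for N :: "'u measure" and Y u x y
  proof -
    have x_H: "x \<in> pverts ?H" "level x \<le> ?L"
      using x depth_le_R_out by (auto simp: original_verts_def pverts_augmentation level_def le_SucI)
    have "(\<forall>y\<in>pverts ?H. u x y = t x y) \<and>
       (\<forall>n. taboo_prob (H.below (Suc ?L)) u ?r n x = taboo_prob (H.below (Suc ?L)) t ?r n x) \<and>
       (\<forall>n. taboo_prob (H.below ?L) u ?r n x = taboo_prob (H.below ?L) t ?r n x)"
    proof (rule H.nearest_neighbor_determined)
      show "H.nearest_neighbor u" "H.nearest_neighbor t"
        using u_chain t_chain nearest_neighbor by (auto simp: nondegenerate_simple_chain_def)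
      show "u x y = t x y" if "x \<in> pverts ?H" "level x = ?L" "y \<in> pverts ?H" for x y
      proof -
        \<comment> \<open>With \<open>l = 2\<close> the inner shell lies one step outside the original tree.\<close>
        have "x \<notin> original_verts G"
          using that depth_le_R_out by (fastforce simp: original_verts_def level_def)
        then show ?thesis using W that leaves by auto
      qed
      show "taboo_prob (H.below (Suc ?L)) u ?r n x = taboo_prob (H.below (Suc ?L)) t ?r n x"
        if "x \<in> pverts ?H" "level x = Suc ?L" for n x
      proof -
        have v: "x \<in> shell ?H ?r (Suc ?L)" using that by (simp add: shell)
        show ?thesis
          using out v hitting_distribution_eq_taboo_prob[OF u_chain H.finite_V shell_sub v]
            hitting_distribution_eq_taboo_prob[OF t_chain H.finite_V shell_sub v]
          unfolding outer_live by metis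
      qed
      show "taboo_prob (H.below ?L) u ?r n x = taboo_prob (H.below ?L) t ?r n x"
        if "x \<in> pverts ?H" "level x = ?L" for n x
      proof -
        have v: "x \<in> shell ?H ?r ?L" using that by (simp add: shell)
        show ?thesis
          using inn v hitting_distribution_eq_taboo_prob[OF u_chain H.finite_V shell_sub v]
            hitting_distribution_eq_taboo_prob[OF t_chain H.finite_V shell_sub v]
          unfolding inner_live by metis
      qed
    qed (use x_H in auto)
    then show ?thesis using y by blast
  qed
  then show ?thesis
    unfolding determined_by_spherical_hitting_times_def Let_def two R diff_Suc_1 by blast
qed

end
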